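(* Let $L$ be a $BL$-algebra, let $\alpha,\beta\in(0,1]$ with $\alpha<\beta$, and let $F:L\to[0,1]$ be a fuzzy set. Then $F$ is a fuzzy fantastic filter with thresholds $(\alpha,\beta]$ of $L$ if and only if for every $t$ with $\alpha<t\le\beta$ for which $U(F;t)=\{x\in L\mid F(x)\ge t\}$ is non-empty, $U(F;t)$ is a fantastic filter of $L$.
   Context: A $BL$-algebra is an algebra $(L,\le,\wedge,\vee,\odot,\rightarrow,0,1)$ that is a bounded lattice (least element $0$, greatest element $1$) such that $(L,\odot,1)$ is a commutative monoid, $z\le x\rightarrow y$ iff $x\odot z\le y$, $x\wedge y=x\odot(x\rightarrow y)$, and $(x\rightarrow y)\vee(y\rightarrow x)=1$, for all $x,y,z\in L$. A filter of $L$ is a non-empty subset $A\subseteq L$ with $1\in A$ such that $x\in A$ and $x\rightarrow y\in A$ imply $y\in A$; it is fantastic if $z\rightarrow(y\rightarrow x)\in A$ and $z\in A$ imply $((x\rightarrow y)\rightarrow y)\rightarrow x\in A$ for all $x,y,z$. A fuzzy set $F$ is a fuzzy fantastic filter with thresholds $(\alpha,\beta]$ of $L$ if for all $x,y,z\in L$: $\max\{F(x\odot y),\alpha\}\ge\min\{F(x),F(y),\beta\}$; whenever $x\le y$, $\max\{F(y),\alpha\}\ge\min\{F(x),\beta\}$; and $\max\{F(((x\rightarrow y)\rightarrow y)\rightarrow x),\alpha\}\ge\min\{F(z\rightarrow(y\rightarrow x)),F(z),\beta\}$. *)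

theory Defs
  imports Complex_Main
begin

(* The least element 0 and the greatest element 1 of a BL-algebra are bot and top
   of the library class bounded_lattice; meet and join are inf and sup. *)
class bl_algebra = bounded_lattice +
  fixes bl_mult :: "'a \<Rightarrow> 'a \<Rightarrow> 'a"  (infixl "\<odot>" 70)
    and bl_imp :: "'a \<Rightarrow> 'a \<Rightarrow> 'a"  (infixr "\<rightarrow>" 60)
  assumes bl_mult_assoc: "(x \<odot> y) \<odot> z = x \<odot> (y \<odot> z)"
    and bl_mult_commute: "x \<odot> y = y \<odot> x"
    and bl_mult_top: "x \<odot> top = x"
    and bl_residuation: "z \<le> (x \<rightarrow> y) \<longleftrightarrow> x \<odot> z \<le> y"
    and bl_divisibility: "inf x y = x \<odot> (x \<rightarrow> y)"
    and bl_prelinearity: "sup (x \<rightarrow> y) (y \<rightarrow> x) = top"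

definition bl_filter :: "'a::bl_algebra set \<Rightarrow> bool" where
  "bl_filter A \<longleftrightarrow> A \<noteq> {} \<and> top \<in> A \<and> (\<forall>x y. x \<in> A \<and> (x \<rightarrow> y) \<in> A \<longrightarrow> y \<in> A)"

definition fantastic_filter :: "'a::bl_algebra set \<Rightarrow> bool" where
  "fantastic_filter A \<longleftrightarrow> bl_filter A \<and>
     (\<forall>x y z. (z \<rightarrow> (y \<rightarrow> x)) \<in> A \<and> z \<in> A \<longrightarrow> (((x \<rightarrow> y) \<rightarrow> y) \<rightarrow> x) \<in> A)"

definition fuzzy_set :: "('a \<Rightarrow> real) \<Rightarrow> bool" where
  "fuzzy_set F \<longleftrightarrow> (\<forall>x. F x \<in> {0..1})"

definition fuzzy_fantastic_filter :: "real \<Rightarrow> real \<Rightarrow> ('a::bl_algebra \<Rightarrow> real) \<Rightarrow> bool" where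
  "fuzzy_fantastic_filter \<alpha> \<beta> F \<longleftrightarrow> fuzzy_set F \<and>
     (\<forall>x y. max (F (x \<odot> y)) \<alpha> \<ge> min (min (F x) (F y)) \<beta>) \<and>
     (\<forall>x y. x \<le> y \<longrightarrow> max (F y) \<alpha> \<ge> min (F x) \<beta>) \<and>
     (\<forall>x y z. max (F (((x \<rightarrow> y) \<rightarrow> y) \<rightarrow> x)) \<alpha> \<ge> min (min (F (z \<rightarrow> (y \<rightarrow> x))) (F z)) \<beta>)"

definition level_set :: "('a \<Rightarrow> real) \<Rightarrow> real \<Rightarrow> 'a set" where
  "level_set F t = {x. F x \<ge> t}"

end

theory Submission
  imports Defs
begin

(* The inequality max a alpha >= min m beta says that every level t in (alpha, beta] reached by m
   is also reached by a. Hence the three inequalities defining a fuzzy fantastic filter translate,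
   level by level, into closure of the level sets under the product, upward closure, and the
   fantastic implication; for non-empty sets the first two characterise filters. *)

lemma max_ge_min_iff_thresholds:
  fixes a m \<alpha> \<beta> :: real
  shows "max a \<alpha> \<ge> min m \<beta> \<longleftrightarrow> (\<forall>t. \<alpha> < t \<and> t \<le> \<beta> \<and> t \<le> m \<longrightarrow> t \<le> a)"
proof
  assume *: "\<forall>t. \<alpha> < t \<and> t \<le> \<beta> \<and> t \<le> m \<longrightarrow> t \<le> a"
  show "max a \<alpha> \<ge> min m \<beta>"
    \<comment> \<open>The critical level is the largest candidate, \<open>min m \<beta>\<close>: if
      it exceeds \<alpha>, the assumption puts it below \<open>a\<close>; otherwise \<alpha> itself
      bounds it.\<close>
    using *[rule_format, of "min m \<beta>"] by linarith
qed auto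

lemma bl_imp_eq_top: "x \<le> y \<Longrightarrow> x \<rightarrow> y = top" for x y :: "'a::bl_algebra"
  using bl_residuation[of top x y] by (simp add: bl_mult_top top_unique)

text \<open>Residuation and divisibility let modus ponens be traded for the product and the order.
  In this form filters match the first two fuzzy conditions, which do not mention
  implication.\<close>

lemma bl_filter_iff:
  "bl_filter A \<longleftrightarrow> A \<noteq> {} \<and> (\<forall>x y. x \<in> A \<and> y \<in> A \<longrightarrow> x \<odot> y \<in> A) \<and>
     (\<forall>x y. x \<in> A \<and> x \<le> y \<longrightarrow> y \<in> A)"
  (is "_ \<longleftrightarrow> ?R")
proof
  assume A: "bl_filter A"
  have mp: "y \<in> A" if "x \<in> A" "x \<rightarrow> y \<in> A" for x y
    using A that unfolding bl_filter_def by blast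
  have up: "y \<in> A" if "x \<in> A" "x \<le> y" for x y
  proof -
    have "top \<in> A"
      using A unfolding bl_filter_def by blast
    then show ?thesis
      using that mp[of x y] by (simp add: bl_imp_eq_top)
  qed
  have "x \<odot> y \<in> A" if "x \<in> A" "y \<in> A" for x y
  proof -
    \<comment> \<open>This is the residual of \<open>x \<odot> y \<le> x \<odot> y\<close>; upward
      closure from \<open>y\<close>, then modus ponens with \<open>x\<close>, yields the
      product.\<close>
    have "y \<le> x \<rightarrow> (x \<odot> y)"
      by (simp add: bl_residuation)
    then show ?thesis
      using that up mp by blast
  qed
  then show ?R
    using A up unfolding bl_filter_def by blast
next
  assume R: ?R
  have "y \<in> A" if "x \<in> A" "x \<rightarrow> y \<in> A" for x y
  proof -
    \<comment> \<open>By divisibility the meet is the product of the two given members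
      \<open>x\<close> and \<open>x \<rightarrow> y\<close>, and it lies below
      \<open>y\<close>.\<close>
    have "inf x y \<in> A"
      using R that by (simp add: bl_divisibility)
    then show ?thesis
      using R inf_le2 by blast
  qed
  moreover have "top \<in> A"
    using R top_greatest by blast
  ultimately show "bl_filter A"
    using R unfolding bl_filter_def by blast
qed

theorem theorem3p3p7:
  fixes F :: "'a::bl_algebra \<Rightarrow> real" and \<alpha> \<beta> :: real
  assumes "\<alpha> \<in> {0<..1}" and "\<beta> \<in> {0<..1}" and "\<alpha> < \<beta>"
    and "fuzzy_set F"
  shows "fuzzy_fantastic_filter \<alpha> \<beta> F \<longleftrightarrow>
    (\<forall>t. \<alpha> < t \<and> t \<le> \<beta> \<and> level_set F t \<noteq> {} \<longrightarrow> fantastic_filter (level_set F t))"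
proof -
  let ?I = "\<lambda>t. \<alpha> < t \<and> t \<le> \<beta>"
  let ?M = "\<lambda>t. \<forall>x y. x \<in> level_set F t \<and> y \<in> level_set F t \<longrightarrow> x \<odot> y \<in> level_set F t"
  let ?U = "\<lambda>t. \<forall>x y. x \<in> level_set F t \<and> x \<le> y \<longrightarrow> y \<in> level_set F t"
  let ?F = "\<lambda>t. \<forall>x y z. z \<rightarrow> (y \<rightarrow> x) \<in> level_set F t \<and> z \<in> level_set F t \<longrightarrow>
      ((x \<rightarrow> y) \<rightarrow> y) \<rightarrow> x \<in> level_set F t"
  let ?C = "\<lambda>t. ?M t \<and> ?U t \<and> ?F t"
  \<comment> \<open>A level lies below \<open>min (F x) (F y)\<close> exactly when both points
    belong to its level set; it remains to move the quantifier over \<open>t\<close>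
    outwards.\<close>
  have M: "(\<forall>x y. max (F (x \<odot> y)) \<alpha> \<ge> min (min (F x) (F y)) \<beta>) \<longleftrightarrow> (\<forall>t. ?I t \<longrightarrow> ?M t)"
    unfolding max_ge_min_iff_thresholds level_set_def by auto
  have U: "(\<forall>x y. x \<le> y \<longrightarrow> max (F y) \<alpha> \<ge> min (F x) \<beta>) \<longleftrightarrow> (\<forall>t. ?I t \<longrightarrow> ?U t)"
    unfolding max_ge_min_iff_thresholds level_set_def by auto
  have F: "(\<forall>x y z. max (F (((x \<rightarrow> y) \<rightarrow> y) \<rightarrow> x)) \<alpha> \<ge>
      min (min (F (z \<rightarrow> (y \<rightarrow> x))) (F z)) \<beta>) \<longleftrightarrow> (\<forall>t. ?I t \<longrightarrow> ?F t)"
    unfolding max_ge_min_iff_thresholds level_set_def by auto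
  have "fuzzy_fantastic_filter \<alpha> \<beta> F \<longleftrightarrow> (\<forall>t. ?I t \<longrightarrow> ?C t)"
    unfolding fuzzy_fantastic_filter_def M U F
    by (simp only: assms(4) simp_thms imp_conjR all_conj_distrib)
  \<comment> \<open>All three closure conditions hold vacuously for an empty level set, which is why
    non-emptiness can appear as a premise.\<close>
  moreover have "?C t \<longleftrightarrow> (level_set F t \<noteq> {} \<longrightarrow> fantastic_filter (level_set F t))" for t
    by (cases "level_set F t = {}") (simp_all add: fantastic_filter_def bl_filter_iff)
  ultimately show ?thesis
    by (simp only: imp_conjL)
qed

end
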